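(* Assume that the difference equation $u_{n+1}=A_nu_n$, $n\in\mathbb{N}_0$, has the dichotomy spectrum $\Sigma_{\mathrm{ED}}=\bigcup_{i=1}^{\ell}[\sigma_i^-,\sigma_i^+]$ with fibers $\mathcal{W}_k^i$ and fiber projectors $\mathcal{P}_{k,i}$, $i=1,\ldots,\ell$, $k\in\mathbb{N}_0$. Then for every $k\in\mathbb{N}_0$ and every $V\in\mathcal{G}(s,d)$, $s=1,\ldots,d$, there exist an index $\overline{j}=\overline{j}(k,V)$ and a constant $C=C(k,V)$ such that for all $j\ge k+\overline{j}$ the following estimate holds: $$\angle\big(\Phi(j,k)V,\ \Phi(j,k)\mathcal{T}_k(V)\big)\le C(k,V)\Big(\max_{i=1,\ldots,\ell-1}\frac{\sigma_{i+1}^+}{\sigma_i^-}\Big)^{j-k},$$ where $\mathcal{T}_k(V)$ is the trace space associated with $V$ at time $k$.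
   Context: Setting: $A_n\in\mathbb{R}^{d,d}$, $n\in\mathbb{N}_0$, are invertible, and $\|A_n\|$, $\|A_n^{-1}\|$ are uniformly bounded in $n$. The solution operator is $\Phi(n,m)=A_{n-1}\cdots A_m$ for $n>m$, $\Phi(n,n)=I$, $\Phi(n,m)=A_n^{-1}\cdots A_{m-1}^{-1}$ for $n<m$. $\|\cdot\|$ is the Euclidean norm of vectors and the associated spectral norm; $\mathcal{R}(P)$ is the range of $P$. $\mathcal{G}(s,d)$ is the Grassmannian of $s$-dimensional subspaces of $\mathbb{R}^d$. For $V,W\in\mathcal{G}(s,d)$, $\angle(V,W)\in[0,\frac{\pi}{2}]$ is the largest principal angle between $V$ and $W$ (its cosine is the smallest singular value of $V_B^\top W_B$, where the columns of $V_B,W_B\in\mathbb{R}^{d,s}$ form orthonormal bases of $V,W$). Exponential dichotomy (ED) on $\mathbb{N}_0$ of a system with solution operator $\Psi$: there are constants $K>0$, $\alpha_s,\alpha_u\in(0,1)$ and projectors $P_n^s$, $P_n^u=I-P_n^s$ ($n\in\mathbb{N}_0$) with $P_n^{s,u}\Psi(n,m)=\Psi(n,m)P_m^{s,u}$ for all $n,m$, and $\|\Psi(n,m)P_m^s\|\le K\alpha_s^{n-m}$, $\|\Psi(m,n)P_n^u\|\le K\alpha_u^{n-m}$ for all $n\ge m$. Dichotomy spectrum: $\Sigma_{\mathrm{ED}}=\{\gamma>0: u_{n+1}=\frac1\gamma A_nu_n \text{ has no ED on }\mathbb{N}_0\}$. It is a union of $\ell\le d$ disjoint intervals $[\sigma_i^-,\sigma_i^+]$,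 $i=1,\ldots,\ell$, with $0<\sigma_\ell^-\le\sigma_\ell^+<\cdots<\sigma_1^-\le\sigma_1^+$. Resolvent intervals: $R_1=(\sigma_1^+,\infty)$, $R_i=(\sigma_i^+,\sigma_{i-1}^-)$ for $i=2,\ldots,\ell+1$, with $\sigma_{\ell+1}^+=0$. Dichotomy projectors: for each $i=1,\ldots,\ell+1$, the scaled systems with $\gamma\in R_i$ have an ED with projectors $P_{n,i}^s$, $P_{n,i}^u=I-P_{n,i}^s$ ($n\in\mathbb{N}_0$) not depending on the choice of $\gamma\in R_i$, which satisfy $P_{n,i}^{s,u}\Phi(n,m)=\Phi(n,m)P_{m,i}^{s,u}$ and, with a constant $K>0$, for all $n\ge m$: $\|\Phi(n,m)P_{m,i}^s\|\le K(\sigma_i^+)^{n-m}$ for $i=1,\ldots,\ell$, and $\|\Phi(m,n)P_{n,i}^u\|\le K(\sigma_{i-1}^-)^{m-n}$ for $i=2,\ldots,\ell+1$. Their ranges form flags: for every $n$, $\{0\}=\mathcal{R}(P_{n,\ell+1}^s)\subseteq\mathcal{R}(P_{n,\ell}^s)\subseteq\cdots\subseteq\mathcal{R}(P_{n,1}^s)=\mathbb{R}^d$ and $\mathbb{R}^d=\mathcal{R}(P_{n,\ell+1}^u)\supseteq\mathcal{R}(P_{n,\ell}^u)\supseteq\cdots\supseteq\mathcal{R}(P_{n,1}^u)=\{0\}$. Spectral fibers: $\mathcal{W}_n^i=\mathcal{R}(P_{n,i}^s)\cap\mathcal{R}(P_{n,i+1}^u)$, $i=1,\ldots,\ell$; fiber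 projectors: $\mathcal{P}_{n,i}=P_{n,i}^sP_{n,i+1}^u=P_{n,i+1}^uP_{n,i}^s$, the projector onto $\mathcal{W}_n^i$ along $\bigoplus_{\nu\ne i}\mathcal{W}_n^\nu$. Trace space of $V\in\mathcal{G}(s,d)$ at time $k$: $$\mathcal{T}_k(V)=\bigoplus_{i=1}^{\ell}\mathcal{P}_{k,i}Q_{k,i}^sV=\bigoplus_{i=1}^{\ell}P_{k,i+1}^u\big(\mathcal{R}(P_{k,i}^s)\cap V\big),$$ where $Q_{k,i}^s$ is the orthogonal projector of $\mathbb{R}^d$ onto $\mathcal{R}(P_{k,i}^s)\cap V$; this space has dimension $s$. For $\ell=1$ the maximum over the empty index set is read as $0$ (in that case $\mathcal{T}_k(V)=V$). *)

theory Defs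
  imports "HOL-Analysis.Analysis"
begin

section \<open>Linear nonautonomous difference equations\<close>

definition spectral_norm :: "real ^ 'd ^ 'd \<Rightarrow> real" where
  "spectral_norm M = onorm (\<lambda>x. M *v x)"

definition mat_range :: "real ^ 'd ^ 'd \<Rightarrow> (real ^ 'd) set" where
  "mat_range M = range (\<lambda>x. M *v x)"

definition projector :: "real ^ 'd ^ 'd \<Rightarrow> bool" where
  "projector P \<longleftrightarrow> P ** P = P"

definition uniformly_invertible :: "(nat \<Rightarrow> real ^ 'd ^ 'd) \<Rightarrow> bool" where
  "uniformly_invertible A \<longleftrightarrow>
     (\<forall>n. invertible (A n)) \<and>
     (\<exists>B. \<forall>n. spectral_norm (A n) \<le> B \<and> spectral_norm (matrix_inv (A n)) \<le> B)"

text \<open>\<open>forward_prod A m k\<close> is \<open>A (m+k-1) ** \<dots> ** A m\<close>, and \<open>backward_prod A n k\<close> is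
  \<open>matrix_inv (A n) ** \<dots> ** matrix_inv (A (n+k-1))\<close>.\<close>

primrec forward_prod :: "(nat \<Rightarrow> real ^ 'd ^ 'd) \<Rightarrow> nat \<Rightarrow> nat \<Rightarrow> real ^ 'd ^ 'd" where
  "forward_prod A m 0 = mat 1"
| "forward_prod A m (Suc k) = A (m + k) ** forward_prod A m k"

primrec backward_prod :: "(nat \<Rightarrow> real ^ 'd ^ 'd) \<Rightarrow> nat \<Rightarrow> nat \<Rightarrow> real ^ 'd ^ 'd" where
  "backward_prod A n 0 = mat 1"
| "backward_prod A n (Suc k) = backward_prod A n k ** matrix_inv (A (n + k))"

definition solution_op :: "(nat \<Rightarrow> real ^ 'd ^ 'd) \<Rightarrow> nat \<Rightarrow> nat \<Rightarrow> real ^ 'd ^ 'd" where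
  "solution_op A n m =
     (if m \<le> n then forward_prod A m (n - m) else backward_prod A n (m - n))"

section \<open>Exponential dichotomy and dichotomy spectrum\<close>

definition ED_with ::
  "(nat \<Rightarrow> nat \<Rightarrow> real ^ 'd ^ 'd) \<Rightarrow> (nat \<Rightarrow> real ^ 'd ^ 'd) \<Rightarrow> (nat \<Rightarrow> real ^ 'd ^ 'd) \<Rightarrow> bool"
where
  "ED_with \<Psi> Ps Pu \<longleftrightarrow>
     (\<forall>n. projector (Ps n) \<and> projector (Pu n) \<and> Pu n = mat 1 - Ps n) \<and>
     (\<forall>n m. Ps n ** \<Psi> n m = \<Psi> n m ** Ps m \<and> Pu n ** \<Psi> n m = \<Psi> n m ** Pu m) \<and>
     (\<exists>K \<alpha>s \<alpha>u. 0 < K \<and> 0 < \<alpha>s \<and> \<alpha>s < 1 \<and> 0 < \<alpha>u \<and> \<alpha>u < 1 \<and>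
        (\<forall>n m. m \<le> n \<longrightarrow>
           spectral_norm (\<Psi> n m ** Ps m) \<le> K * \<alpha>s ^ (n - m) \<and>
           spectral_norm (\<Psi> m n ** Pu n) \<le> K * \<alpha>u ^ (n - m)))"

definition has_ED :: "(nat \<Rightarrow> nat \<Rightarrow> real ^ 'd ^ 'd) \<Rightarrow> bool" where
  "has_ED \<Psi> \<longleftrightarrow> (\<exists>Ps Pu. ED_with \<Psi> Ps Pu)"

definition scaled_op :: "(nat \<Rightarrow> real ^ 'd ^ 'd) \<Rightarrow> real \<Rightarrow> nat \<Rightarrow> nat \<Rightarrow> real ^ 'd ^ 'd" where
  "scaled_op A \<gamma> = solution_op (\<lambda>n. (1 / \<gamma>) *\<^sub>R A n)"

definition ED_spectrum :: "(nat \<Rightarrow> real ^ 'd ^ 'd) \<Rightarrow> real set" where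
  "ED_spectrum A = {\<gamma>. 0 < \<gamma> \<and> \<not> has_ED (scaled_op A \<gamma>)}"

text \<open>The spectral intervals \<open>{\<sigma>m i..\<sigma>p i}\<close>, \<open>i = 1, \<dots>, l\<close>, are numbered from right to left;
  \<open>\<sigma>p (l + 1) = 0\<close> is the convention used for the lowest resolvent interval.\<close>

definition spectral_intervals ::
  "(nat \<Rightarrow> real ^ 'd ^ 'd) \<Rightarrow> nat \<Rightarrow> (nat \<Rightarrow> real) \<Rightarrow> (nat \<Rightarrow> real) \<Rightarrow> bool"
where
  "spectral_intervals A l \<sigma>m \<sigma>p \<longleftrightarrow>
     1 \<le> l \<and> l \<le> CARD('d) \<and>
     (\<forall>i\<in>{1..l}. 0 < \<sigma>m i \<and> \<sigma>m i \<le> \<sigma>p i) \<and>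
     (\<forall>i\<in>{1..<l}. \<sigma>p (i + 1) < \<sigma>m i) \<and>
     \<sigma>p (l + 1) = 0 \<and>
     ED_spectrum A = (\<Union>i\<in>{1..l}. {\<sigma>m i..\<sigma>p i})"

definition resolvent_interval :: "(nat \<Rightarrow> real) \<Rightarrow> (nat \<Rightarrow> real) \<Rightarrow> nat \<Rightarrow> real set" where
  "resolvent_interval \<sigma>m \<sigma>p i =
     (if i = 1 then {\<sigma>p 1<..} else {\<sigma>p i<..<\<sigma>m (i - 1)})"

text \<open>\<open>Ps n i\<close> is the stable dichotomy projector at time \<open>n\<close> belonging to the \<open>i\<close>-th resolvent
  interval. On the half line the kernels of these projectors are not determined by the equation,
  so the projectors are data subject to the conditions below. The rates in the third and fourth
  condition are the end points of the resolvent intervals themselves; this is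
  stronger than what the dichotomies of the scaled equations alone provide.\<close>

definition dichotomy_projectors ::
  "(nat \<Rightarrow> real ^ 'd ^ 'd) \<Rightarrow> nat \<Rightarrow> (nat \<Rightarrow> real) \<Rightarrow> (nat \<Rightarrow> real) \<Rightarrow>
   (nat \<Rightarrow> nat \<Rightarrow> real ^ 'd ^ 'd) \<Rightarrow> (nat \<Rightarrow> nat \<Rightarrow> real ^ 'd ^ 'd) \<Rightarrow> bool"
where
  "dichotomy_projectors A l \<sigma>m \<sigma>p Ps Pu \<longleftrightarrow>
     (\<forall>i\<in>{1..l+1}. \<forall>\<gamma>\<in>resolvent_interval \<sigma>m \<sigma>p i.
        ED_with (scaled_op A \<gamma>) (\<lambda>n. Ps n i) (\<lambda>n. Pu n i)) \<and>
     (\<forall>i\<in>{1..l+1}. \<forall>n m.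
        Ps n i ** solution_op A n m = solution_op A n m ** Ps m i \<and>
        Pu n i ** solution_op A n m = solution_op A n m ** Pu m i) \<and>
     (\<exists>K>0. \<forall>n m. m \<le> n \<longrightarrow>
        (\<forall>i\<in>{1..l}. spectral_norm (solution_op A n m ** Ps m i) \<le> K * \<sigma>p i ^ (n - m)) \<and>
        (\<forall>i\<in>{2..l+1}. spectral_norm (solution_op A m n ** Pu n i)
                         \<le> K * \<sigma>m (i - 1) powi (int m - int n))) \<and>
     (\<forall>n. mat_range (Ps n (l + 1)) = {0} \<and> mat_range (Ps n 1) = UNIV \<and>
          (\<forall>i\<in>{1..l}. mat_range (Ps n (i + 1)) \<subseteq> mat_range (Ps n i))) \<and>
     (\<forall>n. mat_range (Pu n (l + 1)) = UNIV \<and> mat_range (Pu n 1) = {0} \<and>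
          (\<forall>i\<in>{1..l}. mat_range (Pu n i) \<subseteq> mat_range (Pu n (i + 1))))"

section \<open>Spectral fibers and trace spaces\<close>

definition spectral_fiber ::
  "(nat \<Rightarrow> nat \<Rightarrow> real ^ 'd ^ 'd) \<Rightarrow> (nat \<Rightarrow> nat \<Rightarrow> real ^ 'd ^ 'd) \<Rightarrow> nat \<Rightarrow> nat \<Rightarrow> (real ^ 'd) set"
where
  "spectral_fiber Ps Pu n i = mat_range (Ps n i) \<inter> mat_range (Pu n (i + 1))"

definition fiber_projector ::
  "(nat \<Rightarrow> nat \<Rightarrow> real ^ 'd ^ 'd) \<Rightarrow> (nat \<Rightarrow> nat \<Rightarrow> real ^ 'd ^ 'd) \<Rightarrow> nat \<Rightarrow> nat \<Rightarrow> real ^ 'd ^ 'd"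
where
  "fiber_projector Ps Pu n i = Ps n i ** Pu n (i + 1)"

definition orth_proj :: "(real ^ 'd) set \<Rightarrow> real ^ 'd \<Rightarrow> real ^ 'd" where
  "orth_proj U x = (THE y. y \<in> U \<and> (\<forall>z\<in>U. orthogonal (x - y) z))"

text \<open>The sum below is automatically direct, since its \<open>i\<close>-th summand lies in the \<open>i\<close>-th fiber.\<close>

definition trace_space ::
  "(nat \<Rightarrow> nat \<Rightarrow> real ^ 'd ^ 'd) \<Rightarrow> (nat \<Rightarrow> nat \<Rightarrow> real ^ 'd ^ 'd) \<Rightarrow> nat \<Rightarrow> nat \<Rightarrow>
   (real ^ 'd) set \<Rightarrow> (real ^ 'd) set"
where
  "trace_space Ps Pu l k V =
     {\<Sum>i\<in>{1..l}. w i | w. \<forall>i\<in>{1..l}.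
        w i \<in> (\<lambda>v. fiber_projector Ps Pu k i *v orth_proj (mat_range (Ps k i) \<inter> V) v) ` V}"

section \<open>Largest principal angle\<close>

definition grassmannian :: "nat \<Rightarrow> (real ^ 'd) set set" where
  "grassmannian s = {V. subspace V \<and> dim V = s}"

definition orthonormal_basis :: "nat \<Rightarrow> (nat \<Rightarrow> real ^ 'd) \<Rightarrow> (real ^ 'd) set \<Rightarrow> bool" where
  "orthonormal_basis s b V \<longleftrightarrow>
     (\<forall>i<s. \<forall>j<s. b i \<bullet> b j = (if i = j then 1 else 0)) \<and> span (b ` {..<s}) = V"

text \<open>The size \<open>s\<close> of the matrices \<open>V\<^sub>B\<^sup>T W\<^sub>B\<close> varies, so they are functions \<open>nat \<Rightarrow> nat \<Rightarrow> real\<close>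
  read on indices below \<open>s\<close>. The singular values of \<open>M\<close> are the nonnegative square roots of the
  eigenvalues of \<open>M\<^sup>T M\<close>.\<close>

definition cross_gram :: "(nat \<Rightarrow> real ^ 'd) \<Rightarrow> (nat \<Rightarrow> real ^ 'd) \<Rightarrow> nat \<Rightarrow> nat \<Rightarrow> real" where
  "cross_gram b c i j = b i \<bullet> c j"

definition singular_value :: "nat \<Rightarrow> (nat \<Rightarrow> nat \<Rightarrow> real) \<Rightarrow> real \<Rightarrow> bool" where
  "singular_value s M \<sigma> \<longleftrightarrow> 0 \<le> \<sigma> \<and>
     (\<exists>x :: nat \<Rightarrow> real. (\<exists>i<s. x i \<noteq> 0) \<and>
        (\<forall>i<s. (\<Sum>j<s. (\<Sum>r<s. M r i * M r j) * x j) = \<sigma>\<^sup>2 * x i))"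

text \<open>Meaningful for subspaces of equal positive dimension. The value does not depend on the
  chosen bases, because another choice multiplies the matrix by orthogonal matrices on both sides.\<close>

definition subspace_angle :: "(real ^ 'd) set \<Rightarrow> (real ^ 'd) set \<Rightarrow> real" where
  "subspace_angle V W =
     (let s = dim V;
          b = (SOME b. orthonormal_basis s b V);
          c = (SOME c. orthonormal_basis s c W)
      in arccos (LEAST \<sigma>. singular_value s (cross_gram b c) \<sigma>))"

section \<open>The convergence rate\<close>

definition spectral_ratio :: "nat \<Rightarrow> (nat \<Rightarrow> real) \<Rightarrow> (nat \<Rightarrow> real) \<Rightarrow> real" where
  "spectral_ratio l \<sigma>m \<sigma>p =
     (if l = 1 then 0 else Max ((\<lambda>i. \<sigma>p (i + 1) / \<sigma>m i) ` {1..l - 1}))"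

section \<open>Consistency of the definitions\<close>

lemma projector_fixes:
  assumes "projector P"
  shows "x \<in> mat_range P \<longleftrightarrow> P *v x = x"
proof
  assume "x \<in> mat_range P"
  then obtain y where "x = P *v y" unfolding mat_range_def by blast
  then show "P *v x = x" using assms by (simp add: projector_def matrix_vector_mul_assoc)
next
  assume "P *v x = x"
  then have "x = P *v x" by simp
  then show "x \<in> mat_range P" unfolding mat_range_def by (rule range_eqI)
qed

lemma subspace_mat_range: "subspace (mat_range M)"
  unfolding mat_range_def
  using linear_subspace_image[OF matrix_vector_mul_linear subspace_UNIV] by simp

lemma orth_proj_eq: "subspace U \<Longrightarrow> x \<in> U \<Longrightarrow> orth_proj U x = x"
  unfolding orth_proj_def
proof (rule the_equality)
  fix y assume "subspace U" "x \<in> U" and y: "y \<in> U \<and> (\<forall>z\<in>U. orthogonal (x - y) z)"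
  then have "x - y \<in> U" by (simp add: subspace_diff)
  with y have "(x - y) \<bullet> (x - y) = 0" by (auto simp: orthogonal_def)
  then show "y = x" by simp
qed (auto simp: orthogonal_def)

lemma orth_proj_in:
  assumes "subspace U"
  shows "orth_proj U x \<in> U"
proof -
  obtain y z where yz: "y \<in> span U" "\<And>w. w \<in> span U \<Longrightarrow> orthogonal z w" "x = y + z"
    using orthogonal_subspace_decomp_exists by metis
  have U: "span U = U" using assms by (simp add: span_eq_iff)
  have "orth_proj U x = y"
    unfolding orth_proj_def
  proof (rule the_equality)
    show "y \<in> U \<and> (\<forall>w\<in>U. orthogonal (x - y) w)" using yz U by auto
  next
    fix y' assume y': "y' \<in> U \<and> (\<forall>w\<in>U. orthogonal (x - y') w)"
    have d: "y - y' \<in> U" using y' yz U assms by (simp add: subspace_diff)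
    have "(x - y') \<bullet> (y - y') = 0" "z \<bullet> (y - y') = 0"
      using y' d yz(2) U by (auto simp: orthogonal_def)
    then have "(y - y') \<bullet> (y - y') = 0" using yz(3) by (simp add: algebra_simps inner_diff inner_add)
    then show "y' = y" by simp
  qed
  then show ?thesis using yz U by simp
qed

lemma orth_proj_image:
  assumes "subspace R" "subspace V"
  shows "orth_proj (R \<inter> V) ` V = R \<inter> V"
proof -
  have s: "subspace (R \<inter> V)" using assms by (simp add: subspace_inter)
  show ?thesis
  proof
    show "orth_proj (R \<inter> V) ` V \<subseteq> R \<inter> V" using orth_proj_in[OF s] by blast
    show "R \<inter> V \<subseteq> orth_proj (R \<inter> V) ` V"
    proof
      fix x assume "x \<in> R \<inter> V"
      then show "x \<in> orth_proj (R \<inter> V) ` V"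
        using orth_proj_eq[OF s, of x] by (intro image_eqI[of _ _ x]) auto
    qed
  qed
qed

lemma dichotomy_projectorsD:
  assumes "spectral_intervals A l \<sigma>m \<sigma>p" "dichotomy_projectors A l \<sigma>m \<sigma>p Ps Pu" "i \<in> {1..l+1}"
  shows "projector (Ps n i)" "projector (Pu n i)" "Pu n i = mat 1 - Ps n i"
proof -
  have "\<exists>\<gamma>. \<gamma> \<in> resolvent_interval \<sigma>m \<sigma>p i"
  proof (cases "i = 1")
    case True
    then show ?thesis unfolding resolvent_interval_def by (auto intro: gt_ex)
  next
    case False
    have "\<sigma>p i < \<sigma>m (i - 1)"
    proof (cases "i = l + 1")
      case True
      then show ?thesis using assms(1) False unfolding spectral_intervals_def by auto
    next
      case ne: False
      then have "i - 1 \<in> {1..<l}" "i - 1 + 1 = i" using assms(3) False by auto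
      then show ?thesis using assms(1) unfolding spectral_intervals_def by metis
    qed
    then show ?thesis using False dense unfolding resolvent_interval_def by auto
  qed
  then obtain \<gamma> where \<gamma>: "\<gamma> \<in> resolvent_interval \<sigma>m \<sigma>p i" ..
  have "ED_with (scaled_op A \<gamma>) (\<lambda>n. Ps n i) (\<lambda>n. Pu n i)"
    using assms(2)[unfolded dichotomy_projectors_def, THEN conjunct1, THEN bspec, OF assms(3),
      THEN bspec, OF \<gamma>] .
  then show "projector (Ps n i)" "projector (Pu n i)" "Pu n i = mat 1 - Ps n i"
    unfolding ED_with_def by (blast dest: conjunct1)+
qed

lemma fiber_projector_commute:
  assumes "spectral_intervals A l \<sigma>m \<sigma>p" "dichotomy_projectors A l \<sigma>m \<sigma>p Ps Pu" "i \<in> {1..l}"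
  shows "fiber_projector Ps Pu n i = Pu n (i + 1) ** Ps n i"
    and "projector (fiber_projector Ps Pu n i)"
    and "mat_range (fiber_projector Ps Pu n i) = spectral_fiber Ps Pu n i"
proof -
  have i: "i \<in> {1..l+1}" "i + 1 \<in> {1..l+1}" using assms(3) by auto
  note p = dichotomy_projectorsD[OF assms(1,2) i(1), of n]
    and q = dichotomy_projectorsD[OF assms(1,2) i(2), of n]
  have sub: "mat_range (Ps n (i+1)) \<subseteq> mat_range (Ps n i)" "mat_range (Pu n i) \<subseteq> mat_range (Pu n (i+1))"
    using assms(2,3) unfolding dichotomy_projectors_def by auto
  have c: "Ps n i *v (Pu n (i+1) *v x) = Pu n (i+1) *v (Ps n i *v x)" for x
  proof -
    have "Ps n i *v (Ps n (i+1) *v x) = Ps n (i+1) *v x" for x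
      using sub(1) projector_fixes[OF p(1)] unfolding mat_range_def by blast
    moreover have "Pu n (i+1) *v (Pu n i *v x) = Pu n i *v x"
      using sub(2) projector_fixes[OF q(2)] unfolding mat_range_def by blast
    ultimately show ?thesis unfolding p(3) q(3)
      by (simp add: matrix_vector_mult_diff_rdistrib matrix_vector_mult_diff_distrib algebra_simps)
  qed
  then show comm: "fiber_projector Ps Pu n i = Pu n (i + 1) ** Ps n i"
    unfolding fiber_projector_def by (simp add: matrix_eq flip: matrix_vector_mul_assoc)
  show pr: "projector (fiber_projector Ps Pu n i)"
    unfolding projector_def matrix_eq
  proof
    fix x
    have "Ps n i *v (Ps n i *v y) = Ps n i *v y" "Pu n (i+1) *v (Pu n (i+1) *v y) = Pu n (i+1) *v y" for y
      using p(1) q(2) by (simp_all add: projector_def matrix_vector_mul_assoc)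
    then show "(fiber_projector Ps Pu n i ** fiber_projector Ps Pu n i) *v x = fiber_projector Ps Pu n i *v x"
      unfolding fiber_projector_def by (simp add: c[simplified] flip: matrix_vector_mul_assoc)
  qed
  have "x \<in> mat_range (fiber_projector Ps Pu n i) \<longleftrightarrow> x \<in> spectral_fiber Ps Pu n i" for x
    unfolding projector_fixes[OF pr] spectral_fiber_def Int_iff
      projector_fixes[OF p(1)] projector_fixes[OF q(2)]
  proof
    assume *: "fiber_projector Ps Pu n i *v x = x"
    show "Ps n i *v x = x \<and> Pu n (i+1) *v x = x"
    proof
      have x: "x = Ps n i *v (Pu n (i+1) *v x)"
        using * by (simp add: fiber_projector_def matrix_vector_mul_assoc)
      show "Ps n i *v x = x"
        using projector_fixes[OF p(1)] x unfolding mat_range_def by blast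
      show "Pu n (i+1) *v x = x"
        using projector_fixes[OF q(2)] x[unfolded c] unfolding mat_range_def by blast
    qed
  next
    assume "Ps n i *v x = x \<and> Pu n (i+1) *v x = x"
    then show "fiber_projector Ps Pu n i *v x = x"
      unfolding fiber_projector_def by (simp flip: matrix_vector_mul_assoc)
  qed
  then show "mat_range (fiber_projector Ps Pu n i) = spectral_fiber Ps Pu n i" by blast
qed

lemma trace_space_alt:
  assumes "spectral_intervals A l \<sigma>m \<sigma>p" "dichotomy_projectors A l \<sigma>m \<sigma>p Ps Pu" "subspace V"
  shows "trace_space Ps Pu l k V =
     {\<Sum>i\<in>{1..l}. w i | w. \<forall>i\<in>{1..l}.
        w i \<in> (\<lambda>v. Pu k (i + 1) *v v) ` (mat_range (Ps k i) \<inter> V)}"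
proof -
  have "(\<lambda>v. fiber_projector Ps Pu k i *v orth_proj (mat_range (Ps k i) \<inter> V) v) ` V
        = (\<lambda>v. Pu k (i + 1) *v v) ` (mat_range (Ps k i) \<inter> V)" if i: "i \<in> {1..l}" for i
  proof -
    have p: "projector (Ps k i)" using dichotomy_projectorsD(1)[OF assms(1,2)] i by simp
    have "(\<lambda>v. fiber_projector Ps Pu k i *v orth_proj (mat_range (Ps k i) \<inter> V) v) ` V
        = (\<lambda>v. fiber_projector Ps Pu k i *v v) ` (orth_proj (mat_range (Ps k i) \<inter> V) ` V)"
      by (simp add: image_image)
    also have "\<dots> = (\<lambda>v. fiber_projector Ps Pu k i *v v) ` (mat_range (Ps k i) \<inter> V)"
      by (simp only: orth_proj_image[OF subspace_mat_range assms(3)])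
    also have "\<dots> = (\<lambda>v. Pu k (i + 1) *v v) ` (mat_range (Ps k i) \<inter> V)"
    proof (rule image_cong[OF refl])
      fix v assume "v \<in> mat_range (Ps k i) \<inter> V"
      then have "Ps k i *v v = v" using projector_fixes[OF p] by auto
      then show "fiber_projector Ps Pu k i *v v = Pu k (i + 1) *v v"
        unfolding fiber_projector_commute(1)[OF assms(1,2) i]
        by (simp flip: matrix_vector_mul_assoc)
    qed
    finally show ?thesis .
  qed
  then show ?thesis unfolding trace_space_def by simp
qed

end

theory Submission
  imports Defs
begin

text \<open>Write \<open>V\<^sub>i = R(P\<^sup>s\<^sub>k\<^sub>,\<^sub>i) \<inter> V\<close>. The map \<open>P\<^sup>u\<^sub>k\<^sub>,\<^sub>i\<^sub>+\<^sub>1\<close> on \<open>V\<^sub>i\<close> has kernel \<open>V\<^sub>i\<^sub>+\<^sub>1\<close>, so the dimensions of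
  its images add up to \<open>dim V\<close>, and it has a bounded right inverse. Given \<open>w = \<Sum> y\<^sub>i\<close> in the trace
  space, choose preimages \<open>v\<^sub>i \<in> V\<^sub>i\<close> of the \<open>y\<^sub>i\<close> and put \<open>v = \<Sum> v\<^sub>i\<close>. Then \<open>w - v = - \<Sum> P\<^sup>s\<^sub>k\<^sub>,\<^sub>i\<^sub>+\<^sub>1 v\<^sub>i\<close>
  grows at most like \<open>\<sigma>p (i + 1)\<close>, whereas \<open>y\<^sub>i\<close>, which is recovered from \<open>w\<close> by uniformly bounded
  projectors, grows at least like \<open>\<sigma>m i\<close>. Hence every vector of the propagated trace space is
  within relative distance \<open>C \<rho> ^ (j - k)\<close> of the propagated \<open>V\<close>. Because both spaces have the same
  dimension, this one-sided estimate bounds the sine of the largest principal angle.\<close>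

section \<open>Singular values and the largest principal angle\<close>

text \<open>Put \<open>x = 2 * y\<close>. The mean value theorem gives
  \<open>sin y \<ge> y * cos y\<close>, and \<open>cos x \<ge> 0\<close> means
  \<open>2 * (cos y)\<^sup>2 \<ge> 1\<close>; insert both into
  \<open>sin x = 2 * sin y * cos y\<close>.\<close>

lemma half_le_sin:
  fixes x :: real
  assumes "0 \<le> x" "x \<le> pi / 2"
  shows "x / 2 \<le> sin x"
proof (cases "x = 0")
  case False
  define y where "y = x / 2"
  have y: "0 < y" "y \<le> pi / 4" "x = 2 * y" using assms False by (auto simp: y_def)
  obtain z where z: "0 < z" "z < y" "sin y - sin 0 = (y - 0) * cos z"
    using MVT2[of 0 y sin cos] y by auto
  have "cos y \<le> cos z" using z y by (intro cos_monotone_0_pi_le) auto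
  then have s: "y * cos y \<le> sin y" using z(3) y by simp
  have c0: "0 \<le> cos y" using y by (intro cos_ge_zero) auto
  have "0 \<le> cos x" using assms by (intro cos_ge_zero) auto
  then have c: "1 \<le> 2 * (cos y)\<^sup>2" using cos_double_cos[of y] y(3) by simp
  have "y \<le> 2 * (y * cos y) * cos y"
    using mult_left_mono[OF c, of y] y by (simp add: power2_eq_square algebra_simps)
  also have "\<dots> \<le> 2 * sin y * cos y" using s c0 by (intro mult_right_mono) auto
  also have "\<dots> = sin x" using sin_double[of y] y(3) by simp
  finally show ?thesis using y_def by simp
qed simp

text \<open>For nonnegative \<open>\<sigma>\<close> the angle lies in the first quadrant, where its
  sine \<open>sqrt (1 - \<sigma>\<^sup>2) \<le> e\<close> controls it up to the factor 2.\<close>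

lemma arccos_le:
  fixes \<sigma> e :: real
  assumes "0 \<le> \<sigma>" "\<sigma> \<le> 1" "1 - e\<^sup>2 \<le> \<sigma>\<^sup>2" "0 \<le> e"
  shows "arccos \<sigma> \<le> 2 * e"
proof -
  have a: "0 \<le> arccos \<sigma>" "arccos \<sigma> \<le> pi / 2"
    using assms arccos_lbound[of \<sigma>] arccos_le_pi2[of \<sigma>] by auto
  have "sin (arccos \<sigma>) = sqrt (1 - \<sigma>\<^sup>2)" using assms by (intro sin_arccos) auto
  also have "\<dots> \<le> sqrt (e\<^sup>2)" using assms by (intro real_sqrt_le_mono) auto
  finally show ?thesis using half_le_sin[OF a] assms by simp
qed

section \<open>Orthonormal bases and best approximation\<close>

lemma orthonormal_basis_ex:
  assumes "subspace V" "dim V = s"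
  shows "\<exists>b. orthonormal_basis s b V"
proof -
  obtain B where B: "pairwise orthogonal B" "\<And>x. x \<in> B \<Longrightarrow> norm x = 1" "independent B"
    "card B = dim V" "span B = V"
    using orthonormal_basis_subspace[OF assms(1)] by metis
  have "finite B" using B(3) by (rule independent_imp_finite)
  then obtain b where b: "bij_betw b {..<s} B"
    using ex_bij_betw_nat_finite[of B] B(4) assms(2) by (auto simp: atLeast0LessThan)
  have "b i \<bullet> b j = (if i = j then 1 else 0)" if "i < s" "j < s" for i j
  proof (cases "i = j")
    case True
    then show ?thesis using B(2)[of "b i"] b that bij_betwE[OF b] by (simp add: norm_eq_1)
  next
    case False
    then have "b i \<noteq> b j" using b that by (auto simp: bij_betw_def inj_on_def)
    then show ?thesis using False B(1) bij_betwE[OF b] that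
      by (auto simp: pairwise_def orthogonal_def)
  qed
  then show ?thesis using b B(5)
    unfolding orthonormal_basis_def by (intro exI[of _ b]) (simp add: bij_betw_def)
qed

text \<open>The residual is orthogonal to every \<open>b j\<close>, hence to their span, but also
  lies in that span.\<close>

lemma orthonormal_basis_expansion:
  assumes "orthonormal_basis s b V" "v \<in> V"
  shows "v = (\<Sum>i<s. (b i \<bullet> v) *\<^sub>R b i)"
proof -
  let ?d = "v - (\<Sum>i<s. (b i \<bullet> v) *\<^sub>R b i)"
  have o: "b i \<bullet> b j = (if i = j then 1 else 0)" if "i < s" "j < s" for i j
    using assms(1) that by (simp add: orthonormal_basis_def)
  have sp: "span (b ` {..<s}) = V" using assms(1) by (simp add: orthonormal_basis_def)
  have "?d \<bullet> b j = 0" if "j < s" for j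
  proof -
    have "(\<Sum>i<s. (b i \<bullet> v) *\<^sub>R b i) \<bullet> b j = (\<Sum>i<s. if i = j then b i \<bullet> v else 0)"
      unfolding inner_sum_left using o that by (intro sum.cong) auto
    also have "\<dots> = b j \<bullet> v" using that by simp
    finally show ?thesis by (simp add: inner_diff_left inner_commute[of v])
  qed
  then have "orthogonal ?d w" if "w \<in> span (b ` {..<s})" for w
    using orthogonal_to_span[OF that, of ?d] by (auto simp: orthogonal_def)
  moreover have "?d \<in> span (b ` {..<s})"
    using assms(2) sp by (intro span_diff span_sum span_scale) (auto intro: span_base)
  ultimately have "?d \<bullet> ?d = 0" by (auto simp: orthogonal_def)
  then show ?thesis by simp
qed

lemma orthonormal_basis_inner_sum:
  assumes "orthonormal_basis s b V"
  shows "(\<Sum>i<s. x i *\<^sub>R b i) \<bullet> (\<Sum>i<s. y i *\<^sub>R b i) = (\<Sum>i<s. x i * y i)"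
proof -
  have o: "b i \<bullet> b j = (if i = j then 1 else 0)" if "i < s" "j < s" for i j
    using assms(1) that by (simp add: orthonormal_basis_def)
  have "(\<Sum>i<s. x i *\<^sub>R b i) \<bullet> (\<Sum>j<s. y j *\<^sub>R b j)
      = (\<Sum>i<s. \<Sum>j<s. if j = i then x i * y j else 0)"
    unfolding inner_sum_left inner_sum_right using o by (intro sum.cong refl) auto
  also have "\<dots> = (\<Sum>i<s. x i * y i)" by simp
  finally show ?thesis .
qed

text \<open>Both sums are the squared length of the projection \<open>p\<close> of \<open>w\<close>
  onto \<open>V\<close>. The first claim is Bessel's inequality; the second says that no
  \<open>v\<close> in \<open>V\<close> is closer to \<open>w\<close> than \<open>p\<close>.\<close>

lemma orthonormal_basis_norm_le:
  assumes "orthonormal_basis s b V"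
  shows "(\<Sum>i<s. (b i \<bullet> w)\<^sup>2) \<le> (norm w)\<^sup>2"
    and "v \<in> V \<Longrightarrow> (norm w)\<^sup>2 - (norm (w - v))\<^sup>2 \<le> (\<Sum>i<s. (b i \<bullet> w)\<^sup>2)"
proof -
  define p where "p = (\<Sum>i<s. (b i \<bullet> w) *\<^sub>R b i)"
  have pp: "p \<bullet> p = (\<Sum>i<s. (b i \<bullet> w)\<^sup>2)"
    unfolding p_def orthonormal_basis_inner_sum[OF assms] by (simp add: power2_eq_square)
  have wp: "w \<bullet> p = p \<bullet> p"
    unfolding pp by (simp add: p_def inner_sum_right power2_eq_square inner_commute)
  have "0 \<le> (norm (w - p))\<^sup>2" by simp
  then show "(\<Sum>i<s. (b i \<bullet> w)\<^sup>2) \<le> (norm w)\<^sup>2"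
    using wp pp by (simp add: power2_norm_eq_inner inner_diff inner_commute)
  assume v: "v \<in> V"
  have wv: "w \<bullet> v = p \<bullet> v"
    by (subst orthonormal_basis_expansion[OF assms v])
      (simp add: p_def inner_sum_left inner_sum_right inner_commute mult.commute)
  have "0 \<le> (norm (p - v))\<^sup>2" by simp
  then show "(norm w)\<^sup>2 - (norm (w - v))\<^sup>2 \<le> (\<Sum>i<s. (b i \<bullet> w)\<^sup>2)"
    unfolding pp[symmetric] using wv
    by (simp add: power2_norm_eq_inner inner_diff inner_commute)
qed

text \<open>The minimum \<open>m\<close> of the quadratic form \<open>w \<mapsto> \<bar>P\<^sub>V w\<bar>\<^sup>2\<close> on the unit sphere of \<open>W\<close> is its
  smallest eigenvalue, so \<open>sqrt m\<close> is the least singular value.\<close>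

lemma least_singular_value:
  fixes b c :: "nat \<Rightarrow> real ^ 'd"
  assumes b: "orthonormal_basis s b V" and c: "orthonormal_basis s c W" and "0 < s"
  obtains w where "w \<in> W" "norm w = 1"
    "(LEAST \<sigma>. singular_value s (cross_gram b c) \<sigma>) = sqrt (\<Sum>r<s. (b r \<bullet> w)\<^sup>2)"
proof -
  have W: "span (c ` {..<s}) = W" using c by (simp add: orthonormal_basis_def)
  then have subW: "subspace W" by (metis subspace_span)
  \<comment> \<open>\<open>B u v\<close> is the inner product of the orthogonal projections of
    \<open>u\<close> and \<open>v\<close> onto \<open>V\<close>.\<close>
  define B where "B u v = (\<Sum>r<s. (b r \<bullet> u) * (b r \<bullet> v))" for u v :: "real ^ 'd"
  have c_in: "c i \<in> W" if "i < s" for i using W that by (auto intro: span_base)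
  have c_norm: "norm (c i) = 1" if "i < s" for i
    using c that by (simp add: orthonormal_basis_def norm_eq_1)
  let ?S = "sphere 0 1 \<inter> W"
  have "c 0 \<in> ?S" using c_in c_norm \<open>0 < s\<close> by auto
  moreover have "compact ?S"
    using closed_subspace[OF subW] by (intro compact_Int_closed) auto
  moreover have "continuous_on ?S (\<lambda>w. B w w)" unfolding B_def by (intro continuous_intros)
  ultimately obtain w where w: "w \<in> ?S" and min: "\<And>u. u \<in> ?S \<Longrightarrow> B w w \<le> B u u"
    using continuous_attains_inf[of ?S "\<lambda>w. B w w"] by blast
  define m where "m = B w w"
  have m0: "0 \<le> m" unfolding m_def B_def by (intro sum_nonneg) auto
  have low: "m * (u \<bullet> u) \<le> B u u" if u: "u \<in> W" for u
  proof (cases "u = 0")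
    case False
    have "m \<le> B ((1 / norm u) *\<^sub>R u) ((1 / norm u) *\<^sub>R u)"
      unfolding m_def using False u subW by (intro min) (auto simp: subspace_scale)
    also have "\<dots> = B u u / (u \<bullet> u)"
      unfolding B_def by (simp add: sum_divide_distrib dot_square_norm power2_eq_square)
    finally show ?thesis using False by (simp add: field_simps)
  qed (simp add: B_def)
  \<comment> \<open>Lagrange condition for the minimizer: varying \<open>w\<close> in direction
    \<open>u\<close> gives a quadratic in \<open>t\<close> that is nonnegative and vanishes at 0, so
    its linear coefficient \<open>2 * D\<close> must vanish.\<close>
  have crit: "B w u = m * (w \<bullet> u)" if u: "u \<in> W" for u
  proof -
    define D where "D = B w u - m * (w \<bullet> u)"
    define E where "E = B u u - m * (u \<bullet> u)"
    have ww: "w \<bullet> w = 1" using w by (simp add: dot_square_norm)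
    have ineq: "0 \<le> 2 * t * D + t\<^sup>2 * E" for t
    proof -
      have "w + t *\<^sub>R u \<in> W" using w u subW by (auto intro: subspace_add subspace_scale)
      from low[OF this] have "m * (1 + 2 * t * (w \<bullet> u) + t\<^sup>2 * (u \<bullet> u))
          \<le> B (w + t *\<^sub>R u) (w + t *\<^sub>R u)"
        using ww by (simp add: inner_add inner_commute power2_eq_square algebra_simps)
      also have "\<dots> = m + 2 * t * B w u + t\<^sup>2 * B u u"
        unfolding m_def B_def
        by (simp add: inner_add_right sum.distrib sum_distrib_left power2_eq_square algebra_simps)
      finally show ?thesis by (simp add: D_def E_def algebra_simps)
    qed
    have E0: "0 \<le> E" using low[OF u] by (simp add: E_def)
    \<comment> \<open>At \<open>t = - q\<close> the quadratic equals
      \<open>- q\<^sup>2 * (E + 2)\<close>. The summand 1 in the denominator covers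
      \<open>E = 0\<close>.\<close>
    define q where "q = D / (E + 1)"
    have D: "D = q * (E + 1)" using E0 by (simp add: q_def)
    have "q\<^sup>2 * (E + 2) \<le> 0" using ineq[of "- q"] by (simp add: D power2_eq_square algebra_simps)
    then have "D = 0" using E0 by (auto simp: D mult_le_0_iff)
    then show ?thesis by (simp add: D_def)
  qed
  \<comment> \<open>In the coordinates of the basis \<open>c\<close>, the matrix
    \<open>M\<^sup>T M\<close> represents the form \<open>B\<close> on \<open>W\<close>.\<close>
  have gram: "(\<Sum>j<s. (\<Sum>r<s. cross_gram b c r i * cross_gram b c r j) * x j)
      = B (c i) (\<Sum>j<s. x j *\<^sub>R c j)" for i x
  proof -
    have "(\<Sum>j<s. (\<Sum>r<s. cross_gram b c r i * cross_gram b c r j) * x j)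
        = (\<Sum>j<s. \<Sum>r<s. (b r \<bullet> c i) * (x j * (b r \<bullet> c j)))"
      by (simp add: cross_gram_def sum_distrib_left sum_distrib_right mult_ac)
    also have "\<dots> = B (c i) (\<Sum>j<s. x j *\<^sub>R c j)"
      unfolding B_def by (subst sum.swap) (simp add: inner_sum_right sum_distrib_left)
    finally show ?thesis .
  qed
  \<comment> \<open>The coordinates of \<open>w\<close> form an eigenvector, by \<open>crit\<close>
    with \<open>u = c i\<close>.\<close>
  have "singular_value s (cross_gram b c) (sqrt m)"
    unfolding singular_value_def
  proof (intro conjI exI[of _ "\<lambda>i. c i \<bullet> w"])
    have exp: "w = (\<Sum>j<s. (c j \<bullet> w) *\<^sub>R c j)"
      using orthonormal_basis_expansion[OF c] w by blast
    show "\<exists>i<s. c i \<bullet> w \<noteq> 0"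
    proof (rule ccontr)
      assume "\<not> ?thesis"
      then have "w = 0" using exp by simp
      then show False using w by simp
    qed
    show "\<forall>i<s. (\<Sum>j<s. (\<Sum>r<s. cross_gram b c r i * cross_gram b c r j) * (c j \<bullet> w))
        = (sqrt m)\<^sup>2 * (c i \<bullet> w)"
    proof (intro allI impI)
      fix i assume "i < s"
      then have "B w (c i) = m * (w \<bullet> c i)" using crit c_in by blast
      then show "(\<Sum>j<s. (\<Sum>r<s. cross_gram b c r i * cross_gram b c r j) * (c j \<bullet> w))
          = (sqrt m)\<^sup>2 * (c i \<bullet> w)"
        unfolding gram exp[symmetric] using m0 by (simp add: B_def mult.commute inner_commute)
    qed
  qed (use m0 in simp)
  \<comment> \<open>Pairing the eigenvector equation with its own vector gives
    \<open>B u u = \<sigma>\<^sup>2 * (u \<bullet> u)\<close>, and \<open>low\<close> bounds the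
    left side from below.\<close>
  moreover have "sqrt m \<le> \<sigma>" if \<sigma>: "singular_value s (cross_gram b c) \<sigma>" for \<sigma>
  proof -
    obtain x i0 where x: "i0 < s" "x i0 \<noteq> 0" "0 \<le> \<sigma>"
      "\<And>i. i < s \<Longrightarrow> B (c i) (\<Sum>j<s. x j *\<^sub>R c j) = \<sigma>\<^sup>2 * x i"
      using \<sigma> unfolding singular_value_def gram by blast
    define u where "u = (\<Sum>j<s. x j *\<^sub>R c j)"
    have u: "u \<in> W" unfolding u_def using subW c_in by (auto intro: subspace_sum subspace_scale)
    have uu: "u \<bullet> u = (\<Sum>i<s. x i * x i)"
      unfolding u_def by (rule orthonormal_basis_inner_sum[OF c])
    have "0 < u \<bullet> u" unfolding uu using x(1,2)
      by (intro sum_pos2[of _ i0]) (auto simp: less_le)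
    have "B (\<Sum>i<s. x i *\<^sub>R c i) v = (\<Sum>i<s. x i * B (c i) v)" for v
      unfolding B_def inner_sum_right sum_distrib_left sum_distrib_right
      by (subst sum.swap) (simp add: mult.assoc)
    then have "B u u = (\<Sum>i<s. x i * B (c i) u)" unfolding u_def[symmetric] .
    also have "\<dots> = \<sigma>\<^sup>2 * (u \<bullet> u)"
      unfolding uu using x(4) by (simp add: u_def sum_distrib_left mult_ac)
    finally have "m * (u \<bullet> u) \<le> \<sigma>\<^sup>2 * (u \<bullet> u)" using low[OF u] by simp
    then have "m \<le> \<sigma>\<^sup>2" using \<open>0 < u \<bullet> u\<close> by simp
    then show ?thesis using x(3) by (simp add: real_le_lsqrt)
  qed
  ultimately have "(LEAST \<sigma>. singular_value s (cross_gram b c) \<sigma>) = sqrt m"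
    by (rule Least_equality)
  then show thesis using that[of w] w by (simp add: m_def B_def power2_eq_square)
qed

text \<open>The cosine of the angle is the length of the projection onto \<open>V\<close> of a worst
  unit vector \<open>w\<close> of \<open>W\<close>. A point of \<open>V\<close> within
  \<open>e\<close> of \<open>w\<close> makes the squared length at least
  \<open>1 - e\<^sup>2\<close>. Equal dimensions make the cross Gram matrix square.\<close>

lemma subspace_angle_le:
  fixes V W :: "(real ^ 'd) set"
  assumes "subspace V" "subspace W" "dim V = dim W" "0 < dim V" "0 \<le> e"
    and close: "\<And>w. w \<in> W \<Longrightarrow> \<exists>v\<in>V. norm (w - v) \<le> e * norm w"
  shows "subspace_angle V W \<le> 2 * e"
proof -
  define b where "b = (SOME b. orthonormal_basis (dim V) b V)"
  define c where "c = (SOME c. orthonormal_basis (dim V) c W)"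
  have b: "orthonormal_basis (dim V) b V"
    unfolding b_def using orthonormal_basis_ex[OF assms(1) refl] by (rule someI_ex)
  have c: "orthonormal_basis (dim V) c W"
    unfolding c_def using orthonormal_basis_ex[OF assms(2) assms(3)[symmetric]] by (rule someI_ex)
  obtain w where w: "w \<in> W" "norm w = 1" and least:
    "(LEAST \<sigma>. singular_value (dim V) (cross_gram b c) \<sigma>) = sqrt (\<Sum>r<dim V. (b r \<bullet> w)\<^sup>2)"
    using least_singular_value[OF b c assms(4)] by blast
  let ?m = "\<Sum>r<dim V. (b r \<bullet> w)\<^sup>2"
  obtain v where v: "v \<in> V" "norm (w - v) \<le> e" using close[OF w(1)] w(2) by auto
  have m0: "0 \<le> ?m" by (intro sum_nonneg) auto
  have "?m \<le> 1" using orthonormal_basis_norm_le(1)[OF b, of w] w by simp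
  moreover have "1 - e\<^sup>2 \<le> ?m"
    using orthonormal_basis_norm_le(2)[OF b v(1), of w] w power_mono[OF v(2), of 2] by simp
  ultimately have "arccos (sqrt ?m) \<le> 2 * e" using m0 assms(5) by (intro arccos_le) auto
  then show ?thesis unfolding subspace_angle_def Let_def b_def[symmetric] c_def[symmetric] least .
qed

section \<open>Dimension of graded images\<close>

text \<open>Rank-nullity relative to \<open>S\<close>: on the orthogonal complement \<open>R\<close>
  of the kernel within \<open>S\<close>, \<open>f\<close> is injective and already attains its whole
  image.\<close>

lemma dim_kernel_image:
  fixes f :: "'a::euclidean_space \<Rightarrow> 'b::euclidean_space"
  assumes f: "linear f" and S: "subspace S"
  shows "dim {x \<in> S. f x = 0} + dim (f ` S) = dim S"
proof -
  define N where "N = {x \<in> S. f x = 0}"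
  define R where "R = {y \<in> S. \<forall>x\<in>N. orthogonal x y}"
  have "N = S \<inter> f -` {0}" by (auto simp: N_def)
  then have N: "subspace N" "N \<subseteq> S"
    using S f by (auto simp: subspace_inter linear_subspace_vimage)
  have subR: "subspace R" unfolding R_def
    using S by (auto simp: subspace_def orthogonal_clauses)
  have "inj_on f R"
  proof (rule inj_onI)
    fix x y assume xy: "x \<in> R" "y \<in> R" "f x = f y"
    have "x - y \<in> R" using subR xy by (simp add: subspace_diff)
    moreover from this have "x - y \<in> N" using xy f by (simp add: N_def R_def linear_diff)
    ultimately have "orthogonal (x - y) (x - y)" by (simp add: R_def)
    then show "x = y" by (simp add: orthogonal_def)
  qed
  then have "inj_on f (span R)" by (subst span_eq_iff[THEN iffD2, OF subR])
  then have "dim (f ` R) = dim R" by (rule dim_image_eq[OF f])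
  moreover have "f ` R = f ` S"
  proof
    show "f ` S \<subseteq> f ` R"
    proof
      fix z assume "z \<in> f ` S"
      then obtain x where x: "x \<in> S" "z = f x" by blast
      obtain y r where yr: "y \<in> span N" "\<And>w. w \<in> span N \<Longrightarrow> orthogonal r w" "x = y + r"
        using orthogonal_subspace_decomp_exists by metis
      have y: "y \<in> N" using yr(1) unfolding span_eq_iff[THEN iffD2, OF N(1)] .
      have "r = x - y" using yr(3) by simp
      then have "r \<in> S" using x y N S by (auto intro: subspace_diff)
      then have "r \<in> R" using yr(2) by (auto simp: R_def orthogonal_commute span_base)
      moreover have "z = f r" using y yr(3) x(2) f by (simp add: N_def linear_add)
      ultimately show "z \<in> f ` R" by blast
    qed
  qed (auto simp: R_def)
  ultimately show ?thesis
    using dim_subspace_orthogonal_to_vectors[OF N(1) S N(2)] by (simp add: R_def N_def)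
qed

text \<open>The maps \<open>p i\<close> separate the summands and so make the sum direct.\<close>

lemma dim_sum_graded_images:
  fixes F :: "nat \<Rightarrow> 'a::euclidean_space set" and f p :: "nat \<Rightarrow> 'a \<Rightarrow> 'a"
  assumes f: "\<And>i. i \<in> {1..l} \<Longrightarrow> linear (f i)"
    and p: "\<And>i. i \<in> {1..l} \<Longrightarrow> linear (p i)"
    and F: "\<And>i. subspace (F i)" "F (Suc l) = {0}"
    and ker: "\<And>i. i \<in> {1..l} \<Longrightarrow> {x \<in> F i. f i x = 0} = F (Suc i)"
    and sep: "\<And>i j x. i \<in> {1..l} \<Longrightarrow> j \<in> {1..l} \<Longrightarrow> x \<in> f j ` F j \<Longrightarrow>
      p i x = (if i = j then x else 0)"
  defines "T \<equiv> \<lambda>m. {\<Sum>i\<in>{m..l}. w i | w. \<forall>i\<in>{m..l}. w i \<in> f i ` F i}"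
  shows "subspace (T 1) \<and> dim (T 1) = dim (F 1)"
proof (cases "1 \<le> Suc l")
  case True
  then show ?thesis
  \<comment> \<open>Downward induction on the first index: the tail sum \<open>T m\<close> has the
    dimension of \<open>F m\<close>, starting from the empty sum at \<open>Suc l\<close>.\<close>
  proof (induction rule: inc_induct)
    case base
    have "T (Suc l) = {0}" by (simp add: T_def)
    then show ?case by (simp add: F(2) subspace_single_0)
  next
    case (step m)
    then have m: "m \<in> {1..l}" by simp
    have split: "{m..l} = insert m {Suc m..l}" using m by auto
    have T_m: "T m = {x + y | x y. x \<in> f m ` F m \<and> y \<in> T (Suc m)}" (is "_ = ?R")
    proof
      show "T m \<subseteq> ?R" unfolding T_def split by fastforce
      show "?R \<subseteq> T m"
      proof clarsimp
        fix x y assume x: "x \<in> F m" and y: "y \<in> T (Suc m)"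
        obtain w where w: "y = (\<Sum>i\<in>{Suc m..l}. w i)" "\<forall>i\<in>{Suc m..l}. w i \<in> f i ` F i"
          using y by (auto simp: T_def)
        have "f m x + y = (\<Sum>i\<in>{m..l}. (w(m := f m x)) i)" unfolding split w(1) by simp
        moreover have "\<forall>i\<in>{m..l}. (w(m := f m x)) i \<in> f i ` F i" using w(2) x by auto
        ultimately show "f m x + y \<in> T m" unfolding T_def by blast
      qed
    qed
    have img: "subspace (f m ` F m)" using f[OF m] F(1) by (rule linear_subspace_image)
    \<comment> \<open>\<open>p m\<close> fixes the \<open>m\<close>-th image and annihilates all
      later summands.\<close>
    have "f m ` F m \<inter> T (Suc m) = {0}"
    proof
      show "f m ` F m \<inter> T (Suc m) \<subseteq> {0}"
      proof
        fix x assume x: "x \<in> f m ` F m \<inter> T (Suc m)"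
        then obtain w where w: "x = (\<Sum>i\<in>{Suc m..l}. w i)" "\<forall>i\<in>{Suc m..l}. w i \<in> f i ` F i"
          by (auto simp: T_def)
        have "x = p m x" using sep[OF m m] x by simp
        also have "\<dots> = (\<Sum>i\<in>{Suc m..l}. p m (w i))"
          unfolding w(1) by (rule linear_sum[OF p[OF m]])
        also have "\<dots> = 0"
        proof (rule sum.neutral, rule ballI)
          fix i assume i: "i \<in> {Suc m..l}"
          then show "p m (w i) = 0" using sep[OF m, of i "w i"] w(2) m by auto
        qed
        finally show "x \<in> {0}" by simp
      qed
    qed (use img step.IH in \<open>auto simp: subspace_0\<close>)
    moreover have "dim (T m) + dim (f m ` F m \<inter> T (Suc m)) = dim (f m ` F m) + dim (T (Suc m))"
      unfolding T_m using img step.IH by (intro dim_sums_Int) auto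
    moreover have "dim (F (Suc m)) + dim (f m ` F m) = dim (F m)"
      using dim_kernel_image[OF f[OF m] F(1)[of m]] unfolding ker[OF m] .
    moreover have "subspace (T m)" unfolding T_m using img step.IH by (intro subspace_sums) auto
    ultimately show ?case using step.IH by simp
  qed
qed simp

section \<open>Propagation of the trace space\<close>

lemma norm_mv_le: "norm (M *v x) \<le> spectral_norm M * norm x"
  unfolding spectral_norm_def by (rule onorm[OF matrix_vector_mul_bounded_linear])

text \<open>Linear maps between Euclidean spaces are bounded, so preimages in \<open>S\<close> can
  be chosen with norm controlled by a constant that depends only on \<open>f\<close> and
  \<open>S\<close>.\<close>

lemma linear_bounded_right_inverse_on:
  fixes f :: "'a::euclidean_space \<Rightarrow> 'b::euclidean_space"
  assumes "linear f" "subspace S"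
  obtains g B where "\<And>y. g y \<in> S" "\<And>y. y \<in> f ` S \<Longrightarrow> f (g y) = y"
    "0 \<le> B" "\<And>y. norm (g y) \<le> B * norm y"
proof -
  obtain g where g: "range g \<subseteq> S" "linear g" "\<forall>v\<in>f ` S. f (g v) = v"
    using linear_exists_right_inverse_on[OF assms] by blast
  obtain B where "B > 0" "\<And>y. norm (g y) \<le> B * norm y"
    using linear_bounded_pos[OF g(2)] by blast
  with g show thesis by (intro that[of g B]) auto
qed

lemma backward_forward_prod:
  assumes "\<And>n. invertible (A n)"
  shows "backward_prod A m n ** forward_prod A m n = mat 1"
proof (induction n)
  case (Suc n)
  have inv: "matrix_inv (A (m + n)) ** A (m + n) = mat 1"
    using assms[of "m + n"] unfolding invertible_def matrix_inv_def
    by (metis (mono_tags, lifting) someI_ex)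
  have "backward_prod A m (Suc n) ** forward_prod A m (Suc n)
      = backward_prod A m n ** (matrix_inv (A (m + n)) ** A (m + n)) ** forward_prod A m n"
    by (simp add: matrix_mul_assoc)
  then show ?case using Suc inv by simp
qed simp

lemma solution_op_left_inverse:
  assumes "uniformly_invertible A" "k \<le> j"
  shows "solution_op A k j *v (solution_op A j k *v x) = x"
proof (cases "j = k")
  case True
  then show ?thesis by (simp add: solution_op_def)
next
  case False
  have "solution_op A k j ** solution_op A j k = mat 1"
    using backward_forward_prod[of A k "j - k"] assms False
    by (simp add: solution_op_def uniformly_invertible_def)
  then show ?thesis by (simp add: matrix_vector_mul_assoc)
qed

section \<open>Dichotomy projectors acting on vectors\<close>

locale dichotomy_data =
  fixes A :: "nat \<Rightarrow> real ^ 'd ^ 'd" and l :: nat and \<sigma>m \<sigma>p :: "nat \<Rightarrow> real"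
    and Ps Pu :: "nat \<Rightarrow> nat \<Rightarrow> real ^ 'd ^ 'd"
  assumes inv: "uniformly_invertible A"
    and spec: "spectral_intervals A l \<sigma>m \<sigma>p"
    and dich: "dichotomy_projectors A l \<sigma>m \<sigma>p Ps Pu"
begin

abbreviation "\<rho> \<equiv> spectral_ratio l \<sigma>m \<sigma>p"

lemma l_pos: "1 \<le> l" using spec by (simp add: spectral_intervals_def)

lemma sigma_pos: "i \<in> {1..l} \<Longrightarrow> 0 < \<sigma>m i" "i \<in> {1..l} \<Longrightarrow> 0 < \<sigma>p i"
proof -
  have "\<forall>i\<in>{1..l}. 0 < \<sigma>m i \<and> \<sigma>m i \<le> \<sigma>p i" using spec by (simp add: spectral_intervals_def)
  then show "i \<in> {1..l} \<Longrightarrow> 0 < \<sigma>m i" "i \<in> {1..l} \<Longrightarrow> 0 < \<sigma>p i" by force+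
qed

lemma ratio_bound: "i \<in> {1..<l} \<Longrightarrow> \<sigma>p (i + 1) \<le> \<rho> * \<sigma>m i"
proof -
  assume i: "i \<in> {1..<l}"
  have "\<sigma>p (i + 1) / \<sigma>m i \<le> \<rho>"
    unfolding spectral_ratio_def using i by (auto intro!: Max_ge)
  then show ?thesis using sigma_pos(1)[of i] i by (simp add: field_simps)
qed

lemma ratio_nonneg: "0 \<le> \<rho>"
proof (cases "l = 1")
  case False
  have "0 < \<sigma>p 2" "0 < \<sigma>m 1" using sigma_pos l_pos False by auto
  moreover have "\<sigma>p 2 \<le> \<rho> * \<sigma>m 1" using ratio_bound[of 1] l_pos False by (simp add: numeral_2_eq_2)
  ultimately show ?thesis by (smt (verit) mult_neg_pos)
qed (simp add: spectral_ratio_def)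

lemma Pu_eq: "i \<in> {1..l+1} \<Longrightarrow> Pu n i *v x = x - Ps n i *v x"
  using dichotomy_projectorsD(3)[OF spec dich] by (simp add: matrix_vector_mult_diff_rdistrib)

lemma mem_Ps: "i \<in> {1..l+1} \<Longrightarrow> x \<in> mat_range (Ps n i) \<longleftrightarrow> Ps n i *v x = x"
  using dichotomy_projectorsD(1)[OF spec dich] by (rule projector_fixes)

lemma mem_Pu: "i \<in> {1..l+1} \<Longrightarrow> x \<in> mat_range (Pu n i) \<longleftrightarrow> Ps n i *v x = 0"
  using projector_fixes[OF dichotomy_projectorsD(2)[OF spec dich]] Pu_eq by simp

lemma Ps_mono: "i \<le> j \<Longrightarrow> 1 \<le> i \<Longrightarrow> j \<le> l + 1 \<Longrightarrow> mat_range (Ps n j) \<subseteq> mat_range (Ps n i)"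
proof (induction j rule: dec_induct)
  case (step m)
  then have "mat_range (Ps n (m + 1)) \<subseteq> mat_range (Ps n m)"
    using dich unfolding dichotomy_projectors_def by auto
  then show ?case using step by auto
qed simp

lemma Pu_mono: "i \<le> j \<Longrightarrow> 1 \<le> i \<Longrightarrow> j \<le> l + 1 \<Longrightarrow> mat_range (Pu n i) \<subseteq> mat_range (Pu n j)"
proof (induction j rule: dec_induct)
  case (step m)
  then have "mat_range (Pu n m) \<subseteq> mat_range (Pu n (m + 1))"
    using dich unfolding dichotomy_projectors_def by auto
  then show ?case using step by auto
qed simp

lemma commute:
  assumes "i \<in> {1..l+1}"
  shows "Ps n i *v (solution_op A n m *v x) = solution_op A n m *v (Ps m i *v x)"
    and "Pu n i *v (solution_op A n m *v x) = solution_op A n m *v (Pu m i *v x)"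
  using dich assms unfolding dichotomy_projectors_def
  by (auto simp: matrix_vector_mul_assoc)

text \<open>The backward rate is multiplied out to avoid negative exponents, and its index is
  shifted so that \<open>\<sigma>m i\<close> goes with the unstable projector \<open>i + 1\<close>,
  matching the \<open>i\<close>-th fiber.\<close>

lemma rates:
  obtains K where "0 < K"
    "\<And>i n m x. m \<le> n \<Longrightarrow> i \<in> {1..l} \<Longrightarrow>
      norm (solution_op A n m *v (Ps m i *v x)) \<le> K * \<sigma>p i ^ (n - m) * norm x"
    "\<And>i n m x. m \<le> n \<Longrightarrow> i \<in> {1..l} \<Longrightarrow>
      \<sigma>m i ^ (n - m) * norm (solution_op A m n *v (Pu n (i + 1) *v x)) \<le> K * norm x"
proof -
  obtain K where K: "0 < K"
    and s: "\<And>i n m. m \<le> n \<Longrightarrow> i \<in> {1..l} \<Longrightarrow>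
      spectral_norm (solution_op A n m ** Ps m i) \<le> K * \<sigma>p i ^ (n - m)"
    and u: "\<And>i n m. m \<le> n \<Longrightarrow> i \<in> {2..l+1} \<Longrightarrow>
      spectral_norm (solution_op A m n ** Pu n i) \<le> K * \<sigma>m (i - 1) powi (int m - int n)"
    using dich[unfolded dichotomy_projectors_def, THEN conjunct2, THEN conjunct2, THEN conjunct1]
    by fast
  show thesis
  proof (rule that[OF K])
    fix i n m :: nat and x :: "real ^ 'd" assume mn: "m \<le> n" and i: "i \<in> {1..l}"
    show "norm (solution_op A n m *v (Ps m i *v x)) \<le> K * \<sigma>p i ^ (n - m) * norm x"
      unfolding matrix_vector_mul_assoc
      using order_trans[OF norm_mv_le mult_right_mono[OF s[OF mn i]]] by simp
    have "\<sigma>m i powi (int m - int n) = 1 / \<sigma>m i ^ (n - m)"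
    proof -
      have "int m - int n = - int (n - m)" using mn by simp
      then show ?thesis by (simp only: power_int_minus power_int_of_nat inverse_eq_divide)
    qed
    moreover have "spectral_norm (solution_op A m n ** Pu n (i + 1))
        \<le> K * \<sigma>m i powi (int m - int n)"
      using u[OF mn, of "i + 1"] i by auto
    ultimately have "norm (solution_op A m n *v (Pu n (i + 1) *v x))
        \<le> K * (1 / \<sigma>m i ^ (n - m)) * norm x"
      unfolding matrix_vector_mul_assoc
      using order_trans[OF norm_mv_le mult_right_mono] by (metis norm_ge_zero)
    then show "\<sigma>m i ^ (n - m) * norm (solution_op A m n *v (Pu n (i + 1) *v x)) \<le> K * norm x"
      using sigma_pos(1)[OF i] by (simp add: field_simps)
  qed
qed

section \<open>Fiber components, dimension and approximation of the trace space\<close>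

abbreviation stable_part :: "nat \<Rightarrow> (real ^ 'd) set \<Rightarrow> nat \<Rightarrow> (real ^ 'd) set" where
  "stable_part k V i \<equiv> mat_range (Ps k i) \<inter> V"
abbreviation image_part :: "nat \<Rightarrow> (real ^ 'd) set \<Rightarrow> nat \<Rightarrow> (real ^ 'd) set" where
  "image_part k V i \<equiv> (\<lambda>v. Pu k (i + 1) *v v) ` stable_part k V i"

text \<open>This places \<open>image_part k V i\<close> in the \<open>i\<close>-th fiber:
  \<open>v\<close> and \<open>Ps k (i + 1) *v v\<close> both lie in the range of
  \<open>Ps k i\<close>, so their difference does too.\<close>

lemma image_part_fixed:
  assumes "i \<in> {1..l}" "x \<in> image_part k V i"
  shows "Ps k i *v x = x" "Ps k (i + 1) *v x = 0"
proof -
  have i: "i \<in> {1..l+1}" "i + 1 \<in> {1..l+1}" using assms(1) by auto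
  obtain v where v: "v \<in> mat_range (Ps k i)" "x = Pu k (i + 1) *v v" using assms(2) by blast
  show "Ps k (i + 1) *v x = 0" using mem_Pu[OF i(2)] v(2) by (auto simp: mat_range_def)
  have "Ps k (i + 1) *v v \<in> mat_range (Ps k i)"
    using Ps_mono[of i "i + 1" k] assms(1) by (auto simp: mat_range_def)
  then have "x \<in> mat_range (Ps k i)"
    unfolding v(2) Pu_eq[OF i(2)] by (intro subspace_diff subspace_mat_range v(1))
  then show "Ps k i *v x = x" using mem_Ps[OF i(1)] by simp
qed

text \<open>The fiber projector \<open>i\<close> annihilates the other fibers because the flags are
  nested: for \<open>j < i\<close> the factor \<open>Ps k i\<close> kills \<open>x\<close>; for
  \<open>i < j\<close> it fixes \<open>x\<close>, and \<open>Pu k (i + 1)\<close> kills it.\<close>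

lemma image_part_separated:
  assumes i: "i \<in> {1..l}" and j: "j \<in> {1..l}" and x: "x \<in> image_part k V j"
  shows "Pu k (i + 1) *v (Ps k i *v x) = (if i = j then x else 0)"
proof -
  note fx = image_part_fixed[OF j x]
  have ij: "i \<in> {1..l+1}" "i + 1 \<in> {1..l+1}" "j \<in> {1..l+1}" "j + 1 \<in> {1..l+1}" using i j by auto
  consider "i = j" | "j < i" | "i < j" by linarith
  then show ?thesis
  proof cases
    case 1
    then show ?thesis using fx Pu_eq[OF ij(2)] by simp
  next
    case 2
    then have "x \<in> mat_range (Pu k i)"
      using fx(2) mem_Pu[OF ij(4)] Pu_mono[of "j + 1" i k] i j by auto
    then show ?thesis using mem_Pu[OF ij(1)] 2 by simp
  next
    case 3
    have "x \<in> mat_range (Ps k (i + 1))" "x \<in> mat_range (Ps k i)"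
      using fx(1) mem_Ps[OF ij(3)] Ps_mono[of "i + 1" j k] Ps_mono[of i j k] i j 3 by auto
    then show ?thesis using mem_Ps[OF ij(1)] mem_Ps[OF ij(2)] Pu_eq[OF ij(2)] 3 by simp
  qed
qed

lemma trace_space_dim:
  assumes V: "subspace V"
  shows "subspace (trace_space Ps Pu l k V) \<and> dim (trace_space Ps Pu l k V) = dim V"
proof -
  have ends: "mat_range (Ps k 1) = UNIV" "mat_range (Ps k (Suc l)) = {0}"
    using dich unfolding dichotomy_projectors_def by simp_all
  have F: "subspace (stable_part k V i)" for i using V by (intro subspace_inter subspace_mat_range)
  \<comment> \<open>The sets \<open>stable_part k V i\<close> form a descending filtration from
    \<open>V\<close> to \<open>{0}\<close>, and each map has the next member as its kernel.\<close>
  have ker: "{x \<in> stable_part k V i. Pu k (i + 1) *v x = 0} = stable_part k V (Suc i)" if i: "i \<in> {1..l}" for i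
    using i Pu_eq[of "i + 1" k] mem_Ps[of "i + 1" _ k] Ps_mono[of i "i + 1" k] by auto
  have "stable_part k V (Suc l) = {0}" using ends(2) subspace_0[OF V] by auto
  note D = dim_sum_graded_images[of l "\<lambda>i v. Pu k (i + 1) *v v"
      "\<lambda>i v. Pu k (i + 1) *v (Ps k i *v v)", OF _ _ F this ker image_part_separated]
  show ?thesis unfolding trace_space_alt[OF spec dich V] using D ends(1)
    by (simp add: matrix_vector_mul_assoc)
qed

text \<open>The vector \<open>v\<close> and the constant are fixed before \<open>j\<close>. The
  constant depends on \<open>k\<close> and \<open>V\<close> through the bounds \<open>B i\<close> of
  the right inverses.\<close>

lemma trace_space_close:
  assumes V: "subspace V"
  obtains C where "0 \<le> C"
    "\<And>w. w \<in> trace_space Ps Pu l k V \<Longrightarrow> \<exists>v\<in>V. \<forall>j\<ge>k.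
      norm (solution_op A j k *v (w - v)) \<le> C * \<rho> ^ (j - k) * norm (solution_op A j k *v w)"
proof -
  obtain K where K: "0 < K"
    and stab: "\<And>i n m x. m \<le> n \<Longrightarrow> i \<in> {1..l} \<Longrightarrow>
      norm (solution_op A n m *v (Ps m i *v x)) \<le> K * \<sigma>p i ^ (n - m) * norm x"
    and unst: "\<And>i n m x. m \<le> n \<Longrightarrow> i \<in> {1..l} \<Longrightarrow>
      \<sigma>m i ^ (n - m) * norm (solution_op A m n *v (Pu n (i + 1) *v x)) \<le> K * norm x"
    using rates by blast
  have F: "subspace (stable_part k V i)" for i using V by (intro subspace_inter subspace_mat_range)
  let ?P = "\<lambda>i g B. (\<forall>y. g y \<in> stable_part k V i) \<and> (\<forall>y\<in>image_part k V i. Pu k (i + 1) *v g y = y) \<and>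
      0 \<le> B \<and> (\<forall>y. norm (g y) \<le> B * norm y)"
  have "\<exists>g B. ?P i g B" for i
    by (rule linear_bounded_right_inverse_on[OF matrix_vector_mul_linear[of "Pu k (i + 1)"] F[of i]])
      (intro exI conjI allI ballI; assumption)
  then have "\<exists>g. \<forall>i. \<exists>B. ?P i (g i) B" by (intro choice allI)
  then obtain g where "\<forall>i. \<exists>B. ?P i (g i) B" ..
  then have "\<exists>B. \<forall>i. ?P i (g i) (B i)" by (rule choice)
  then obtain B where g: "\<And>i y. g i y \<in> stable_part k V i"
      "\<And>i y. y \<in> image_part k V i \<Longrightarrow> Pu k (i + 1) *v g i y = y"
    and B: "\<And>i. 0 \<le> B i" "\<And>i y. norm (g i y) \<le> B i * norm y"
    by blast
  \<comment> \<open>One factor \<open>K\<close> comes from the forward growth of the error; the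
    other three bound \<open>y i\<close>: one for backward growth and two for the projectors at time
    \<open>j\<close>.\<close>
  define C where "C = (\<Sum>i\<in>{1..l}. K * B i * (K * (K * K)))"
  have "0 \<le> C" unfolding C_def using K B(1) by (intro sum_nonneg) simp
  moreover have "\<exists>v\<in>V. \<forall>j\<ge>k. norm (solution_op A j k *v (w - v))
      \<le> C * \<rho> ^ (j - k) * norm (solution_op A j k *v w)" if w: "w \<in> trace_space Ps Pu l k V" for w
  proof -
    obtain y where y: "w = (\<Sum>i\<in>{1..l}. y i)" "\<And>i. i \<in> {1..l} \<Longrightarrow> y i \<in> image_part k V i"
      using w unfolding trace_space_alt[OF spec dich V] by blast
    define v where "v = (\<Sum>i\<in>{1..l}. g i (y i))"
    have "v \<in> V" unfolding v_def using g(1) V by (intro subspace_sum) auto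
    moreover have "norm (solution_op A j k *v (w - v))
        \<le> C * \<rho> ^ (j - k) * norm (solution_op A j k *v w)" if j: "k \<le> j" for j
    proof -
      let ?\<Phi> = "solution_op A j k" and ?n = "j - k"
      have term_le: "norm (?\<Phi> *v (y i - g i (y i)))
          \<le> K * B i * (K * (K * K)) * (\<rho> ^ ?n * norm (?\<Phi> *v w))" if i: "i \<in> {1..l}" for i
      proof -
        have i': "i \<in> {1..l+1}" "i + 1 \<in> {1..l+1}" using i by auto
        have "y i - g i (y i) = - (Ps k (i + 1) *v g i (y i))"
          using g(2)[OF y(2)[OF i]] Pu_eq[OF i'(2), of k "g i (y i)"] by (simp add: algebra_simps)
        then have diff: "norm (?\<Phi> *v (y i - g i (y i))) = norm (?\<Phi> *v (Ps k (i + 1) *v g i (y i)))"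
          by (simp add: linear_neg[OF matrix_vector_mul_linear])
        show ?thesis
        \<comment> \<open>The last fiber has no ratio \<open>\<sigma>p (i + 1) / \<sigma>m i\<close>
          in the maximum, but there \<open>Ps k (l + 1)\<close> is zero and the error vanishes. This
          also settles \<open>l = 1\<close>.\<close>
        proof (cases "i = l")
          case True
          have "mat_range (Ps k (l + 1)) = {0}"
            using dich unfolding dichotomy_projectors_def by blast
          then have "Ps k (i + 1) *v g i (y i) = 0" using True by (auto simp: mat_range_def)
          then show ?thesis using diff K B(1) ratio_nonneg by simp
        next
          case False
          have fiber: "Pu k (i + 1) *v (Ps k i *v w) = y i"
          proof -
            have "Pu k (i + 1) *v (Ps k i *v w)
                = (\<Sum>\<nu>\<in>{1..l}. Pu k (i + 1) *v (Ps k i *v y \<nu>))"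
              unfolding y(1) by (simp add: vec.linear_sum[OF matrix_vector_mul_linear_gen])
            also have "\<dots> = (\<Sum>\<nu>\<in>{1..l}. if i = \<nu> then y \<nu> else 0)"
              using image_part_separated[OF i _ y(2)] by (intro sum.cong refl)
            finally show ?thesis using i by simp
          qed
          have "?\<Phi> *v y i = Pu j (i + 1) *v (Ps j i *v (?\<Phi> *v w))"
            by (simp only: commute[OF i'(1)] commute[OF i'(2)] fiber)
          \<comment> \<open>At equal times the dichotomy rates bound the projectors themselves by
            \<open>K\<close>, uniformly in \<open>j\<close>.\<close>
          moreover have "norm (Pu j (i + 1) *v (Ps j i *v (?\<Phi> *v w)))
              \<le> K * norm (Ps j i *v (?\<Phi> *v w))"
            using unst[OF order_refl i] by (simp add: solution_op_def)
          moreover have "norm (Ps j i *v (?\<Phi> *v w)) \<le> K * norm (?\<Phi> *v w)"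
            using stab[OF order_refl i] by (simp add: solution_op_def)
          ultimately have proj: "norm (?\<Phi> *v y i) \<le> K * (K * norm (?\<Phi> *v w))"
            by (smt (verit) K mult_left_mono)
          \<comment> \<open>The propagated \<open>y i\<close> stays in the unstable range, so
            pulling it back to time \<open>k\<close> bounds its growth from below.\<close>
          have "Pu j (i + 1) *v (?\<Phi> *v y i) = ?\<Phi> *v y i"
            using commute(2)[OF i'(2)] Pu_eq[OF i'(2)] image_part_fixed(2)[OF i y(2)[OF i]] by simp
          then have "\<sigma>m i ^ ?n * norm (y i) \<le> K * norm (?\<Phi> *v y i)"
            using unst[OF j i, of "?\<Phi> *v y i"] solution_op_left_inverse[OF inv j] by simp
          also have "\<dots> \<le> K * (K * (K * norm (?\<Phi> *v w)))"
            using proj K by (intro mult_left_mono) auto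
          finally have grow: "\<sigma>m i ^ ?n * norm (y i) \<le> K * (K * (K * norm (?\<Phi> *v w)))" .
          have "norm (?\<Phi> *v (Ps k (i + 1) *v g i (y i))) \<le> K * \<sigma>p (i + 1) ^ ?n * norm (g i (y i))"
            using stab[OF j, of "i + 1"] i False by auto
          \<comment> \<open>Trading \<open>\<sigma>p (i + 1)\<close> for
            \<open>\<rho> * \<sigma>m i\<close> produces the factor \<open>\<sigma>m i ^ ?n\<close>
            that \<open>grow\<close> absorbs.\<close>
          also have "\<dots> \<le> K * (\<rho> * \<sigma>m i) ^ ?n * (B i * norm (y i))"
            using K B ratio_bound[of i] sigma_pos(2)[of "i + 1"] i False
            by (intro mult_mono power_mono) (auto intro: order_trans)
          also have "\<dots> = K * B i * \<rho> ^ ?n * (\<sigma>m i ^ ?n * norm (y i))"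
            by (simp add: power_mult_distrib)
          also have "\<dots> \<le> K * B i * \<rho> ^ ?n * (K * (K * (K * norm (?\<Phi> *v w))))"
            using grow K B(1) ratio_nonneg by (intro mult_left_mono) auto
          finally show ?thesis unfolding diff by (simp add: mult_ac)
        qed
      qed
      have sum: "?\<Phi> *v (w - v) = (\<Sum>i\<in>{1..l}. ?\<Phi> *v (y i - g i (y i)))"
        unfolding y(1) v_def sum_subtractf[symmetric]
        by (rule vec.linear_sum[OF matrix_vector_mul_linear_gen])
      have "norm (?\<Phi> *v (w - v))
          \<le> (\<Sum>i\<in>{1..l}. K * B i * (K * (K * K)) * (\<rho> ^ ?n * norm (?\<Phi> *v w)))"
        unfolding sum by (intro sum_norm_le term_le)
      then show ?thesis unfolding C_def by (simp add: sum_distrib_right mult.assoc)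
    qed
    ultimately show ?thesis by blast
  qed
  ultimately show thesis by (rule that)
qed

lemma angle_bound:
  assumes V: "subspace V" "0 < dim V"
  shows "\<exists>C. \<forall>j\<ge>k. subspace_angle ((\<lambda>v. solution_op A j k *v v) ` V)
      ((\<lambda>v. solution_op A j k *v v) ` trace_space Ps Pu l k V) \<le> C * \<rho> ^ (j - k)"
proof -
  obtain C where C: "0 \<le> C" and close: "\<And>w. w \<in> trace_space Ps Pu l k V \<Longrightarrow> \<exists>v\<in>V. \<forall>j\<ge>k.
      norm (solution_op A j k *v (w - v)) \<le> C * \<rho> ^ (j - k) * norm (solution_op A j k *v w)"
    using trace_space_close[OF V(1)] by blast
  note T = trace_space_dim[OF V(1), of k]
  have "subspace_angle ((\<lambda>v. solution_op A j k *v v) ` V)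
      ((\<lambda>v. solution_op A j k *v v) ` trace_space Ps Pu l k V) \<le> 2 * (C * \<rho> ^ (j - k))"
    if j: "k \<le> j" for j
  proof -
    \<comment> \<open>Injectivity of the solution operator carries the equality of dimensions from
      time \<open>k\<close> to time \<open>j\<close>.\<close>
    have inj: "inj_on (\<lambda>v. solution_op A j k *v v) S" for S
      using solution_op_left_inverse[OF inv j] by (metis inj_onI)
    have dim: "dim ((\<lambda>v. solution_op A j k *v v) ` S) = dim S" for S
      by (intro dim_image_eq matrix_vector_mul_linear inj)
    show ?thesis
    proof (rule subspace_angle_le)
      fix w assume "w \<in> (\<lambda>v. solution_op A j k *v v) ` trace_space Ps Pu l k V"
      then obtain w' where w': "w' \<in> trace_space Ps Pu l k V" "w = solution_op A j k *v w'" by blast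
      obtain v where "v \<in> V" "norm (solution_op A j k *v (w' - v))
          \<le> C * \<rho> ^ (j - k) * norm (solution_op A j k *v w')"
        using close[OF w'(1)] j by blast
      then show "\<exists>v\<in>(\<lambda>v. solution_op A j k *v v) ` V. norm (w - v) \<le> C * \<rho> ^ (j - k) * norm w"
        unfolding w'(2) by (auto simp: matrix_vector_mult_diff_distrib)
    qed (use V T C ratio_nonneg in
        \<open>simp_all add: dim linear_subspace_image[OF matrix_vector_mul_linear]\<close>)
  qed
  then show ?thesis by (intro exI[of _ "2 * C"]) (simp add: mult.assoc)
qed

end

theorem theorem3p4:
  fixes A :: "nat \<Rightarrow> real ^ 'd ^ 'd"
    and l :: nat and \<sigma>m \<sigma>p :: "nat \<Rightarrow> real"
    and Ps Pu :: "nat \<Rightarrow> nat \<Rightarrow> real ^ 'd ^ 'd"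
  assumes "uniformly_invertible A"
    and "spectral_intervals A l \<sigma>m \<sigma>p"
    and "dichotomy_projectors A l \<sigma>m \<sigma>p Ps Pu"
  shows "\<forall>k. \<forall>s\<in>{1..CARD('d)}. \<forall>V\<in>(grassmannian s :: (real ^ 'd) set set).
    \<exists>(jbar::nat) (C::real). \<forall>j\<ge>k + jbar.
      subspace_angle ((\<lambda>v. solution_op A j k *v v) ` V)
                     ((\<lambda>v. solution_op A j k *v v) ` trace_space Ps Pu l k V)
        \<le> C * spectral_ratio l \<sigma>m \<sigma>p ^ (j - k)"
proof (intro allI ballI)
  fix k s and V :: "(real ^ 'd) set"
  assume "s \<in> {1..CARD('d)}" "V \<in> grassmannian s"
  then have V: "subspace V" "0 < dim V" by (auto simp: grassmannian_def)
  interpret dichotomy_data A l \<sigma>m \<sigma>p Ps Pu using assms by unfold_locales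
  show "\<exists>(jbar::nat) (C::real). \<forall>j\<ge>k + jbar.
      subspace_angle ((\<lambda>v. solution_op A j k *v v) ` V)
                     ((\<lambda>v. solution_op A j k *v v) ` trace_space Ps Pu l k V)
        \<le> C * spectral_ratio l \<sigma>m \<sigma>p ^ (j - k)"
    \<comment> \<open>The estimate already holds from \<open>j = k\<close> on, so the index witness
      is 0.\<close>
    using angle_bound[OF V, of k] by (intro exI[of _ "0::nat"]) (simp only: add_0_right)
qed

end
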